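(* Let $I_1,I_2,I_3$ be three subsets of $[n]$ such that $\cup_{j=1}^3I_j=[n]$, $I_j\not\subseteq I_k$ for each $j\ne k$, and $I_i\cap I_3\neq\emptyset$ for $i=1,2$. Assume that the sub-graphs of the comparison graph induced by the $I_j$'s are connected. Let $\boldsymbol\theta^*$ be the vector of preference scores in the Bradley–Terry–Luce (BTL) model over $n$ items and let $\hat{\boldsymbol\theta}_{(j)}\in\mathbb R^{|I_j|}$ be the MLE of $\boldsymbol\theta^*_{(j)}\in\mathbb R^{|I_j|}$ for the BTL model involving only items in $I_j$, $j=1,2,3$, with augmented versions $\tilde{\boldsymbol\theta}_{(j)}\in\mathbb R^n$ such that $\tilde{\boldsymbol\theta}_{(j)}(I_j)=\hat{\boldsymbol\theta}_{(j)}$. Take two nodes $t_1\in I_1\cap I_3$, $t_2\in I_2\cap I_3$, and let $\delta_3=\tilde{\boldsymbol\theta}_{(1)}(t_1)-\tilde{\boldsymbol\theta}_{(3)}(t_1)$ and $\delta_2=\tilde{\boldsymbol\theta}_{(3)}(t_2)-\tilde{\boldsymbol\theta}_{(2)}(t_2)$. An ensemble estimator (add-MLE) $\hat{\boldsymbol\theta}\in\mathbb R^n$ is the vector such that $\hat{\boldsymbol\theta}(I_1)=\hat{\boldsymbol\theta}_{(1)}$, $\hat{\boldsymbol\theta}(S_2)=\tilde{\boldsymbol\theta}_{(2)}(S_2)+\delta_3+\delta_2$, and $\hat{\boldsymbol\theta}(S_3)=\tilde{\boldsymbol\theta}_{(3)}(S_3)+\delta_3$, where $S_2=I_2\setminus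 I_1$ and $S_3=I_3\setminus(I_1\cup I_2)$. Then for any such ensemble estimator $\hat{\boldsymbol\theta}$, $$d_\infty(\hat{\boldsymbol\theta},\boldsymbol\theta^* )\le4\sum_{i=1}^3d_\infty(\hat{\boldsymbol\theta}_{(i)},\boldsymbol\theta^*_{(i)}).$$
   Context: For a vector $\mathbf v\in\mathbb R^n$ and $I\subseteq[n]$, $\mathbf v(I)$ is the subvector with coordinates in $I$ and $\mathbf v(t)$ is the $t$-th entry; adding a scalar to a vector means adding it to every entry. Entries of $\tilde{\boldsymbol\theta}_{(j)}$ outside $I_j$ are set to $0$ (they play no role). $\boldsymbol\theta^*_{(j)}$ is the preference-score vector of the items in $I_j$, i.e. $\boldsymbol\theta^*(I_j)$ (up to adding a constant vector, which does not affect $d_\infty$). $d_\infty(\mathbf v_1,\mathbf v_2)=\|(\mathbf v_1-\mathrm{avg}(\mathbf v_1)\mathbf 1)-(\mathbf v_2-\mathrm{avg}(\mathbf v_2)\mathbf 1)\|_\infty$, where $\mathrm{avg}(\mathbf x)$ is the average of the entries of $\mathbf x$ ($\frac1n\mathbf 1_n^\top\mathbf x$ for $\mathbf x\in\mathbb R^n$) and $\mathbf 1$ is the all-ones vector. BTL model: outcomes of comparisons along edges of an undirected comparison graph on $[n]$ are independent, with item $i$ beating item $j$ with probability $\psi(\theta_i^*-\theta_j^* )$, $\psi(t)=1/(1+e^{-t})$. The MLE on $I_j$ is the minimizer, over vectors indexed by $I_j$ with entries summing to $0$, of the negative log-likelihood $-\sum_{a<b}A_{ab}\{\bar y_{ab}\log\psi(\theta_a-\theta_b)+(1-\bar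 y_{ab})\log[1-\psi(\theta_a-\theta_b)]\}$ (sum over $a,b\in I_j$; $A$ is the adjacency matrix; $\bar y_{ab}$ is the observed fraction of wins of $a$ over $b$) plus the regularizer $\frac\rho2\|\boldsymbol\theta\|_2^2$. The number of comparisons per pair may differ across the three sub-graphs. *)

theory Defs
  imports "HOL-Probability.Probability" "Graph_Theory.Graph_Theory"
begin

text \<open>
  A vector whose coordinates are indexed by a finite set \<open>I\<close> of items is represented by a
  function \<open>nat \<Rightarrow> real\<close> of which only the values on \<open>I\<close> matter; thus the restriction
  of a vector to a subset of coordinates is the same function, read on that subset.
\<close>

definition avg :: "nat set \<Rightarrow> (nat \<Rightarrow> real) \<Rightarrow> real" where
  "avg I v = (\<Sum>i\<in>I. v i) / real (card I)"

text \<open>\<open>Max\<close> is meaningful only for finite nonempty \<open>I\<close>.\<close>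

definition d_inf :: "nat set \<Rightarrow> (nat \<Rightarrow> real) \<Rightarrow> (nat \<Rightarrow> real) \<Rightarrow> real" where
  "d_inf I v w = Max ((\<lambda>i. \<bar>(v i - avg I v) - (w i - avg I w)\<bar>) ` I)"

definition augment :: "nat set \<Rightarrow> (nat \<Rightarrow> real) \<Rightarrow> nat \<Rightarrow> real" where
  "augment I v i = (if i \<in> I then v i else 0)"

definition psi :: "real \<Rightarrow> real" where
  "psi t = 1 / (1 + exp (- t))"

text \<open>
  The comparison graph \<open>G\<close> is a finite simple undirected graph, i.e. an irreflexive symmetric
  digraph without parallel arcs. The edge between \<open>a < b\<close> is compared \<open>L a b\<close> times, and
  \<open>Y a b l \<omega>\<close> says that \<open>a\<close> beats \<open>b\<close> in the comparison number \<open>l\<close>; each unordered pair is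
  listed once, smaller item first.
\<close>

locale btl_model = prob_space M + pair_graph G
  for M :: "'w measure" and G :: "nat pair_pre_digraph" +
  fixes \<theta> :: "nat \<Rightarrow> real"
    and L :: "nat \<Rightarrow> nat \<Rightarrow> nat"
    and Y :: "nat \<Rightarrow> nat \<Rightarrow> nat \<Rightarrow> 'w \<Rightarrow> bool"
  assumes num_comparisons_pos:
      "\<And>a b. (a, b) \<in> parcs G \<Longrightarrow> a < b \<Longrightarrow> 0 < L a b"
    and outcomes_indep:
      "indep_vars (\<lambda>_. count_space UNIV) (\<lambda>(a, b, l). Y a b l)
         {(a, b, l). (a, b) \<in> parcs G \<and> a < b \<and> l < L a b}"
    and outcome_prob:
      "\<And>a b l. (a, b) \<in> parcs G \<Longrightarrow> a < b \<Longrightarrow> l < L a b \<Longrightarrow>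
         prob {\<omega> \<in> space M. Y a b l \<omega>} = psi (\<theta> a - \<theta> b)"

definition adj :: "nat pair_pre_digraph \<Rightarrow> nat \<Rightarrow> nat \<Rightarrow> real" where
  "adj G a b = (if (a, b) \<in> parcs G then 1 else 0)"

text \<open>
  Fraction of the comparisons numbered by \<open>K a b\<close> that \<open>a\<close> wins, for the realization \<open>\<omega>\<close>.
\<close>

definition win_frac ::
    "(nat \<Rightarrow> nat \<Rightarrow> nat \<Rightarrow> 'w \<Rightarrow> bool) \<Rightarrow> (nat \<Rightarrow> nat \<Rightarrow> nat set) \<Rightarrow> 'w \<Rightarrow> nat \<Rightarrow> nat \<Rightarrow> real" where
  "win_frac Y K \<omega> a b = real (card {l \<in> K a b. Y a b l \<omega>}) / real (card (K a b))"

definition neg_log_lik ::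
    "nat pair_pre_digraph \<Rightarrow> nat set \<Rightarrow> (nat \<Rightarrow> nat \<Rightarrow> real) \<Rightarrow> (nat \<Rightarrow> real) \<Rightarrow> real" where
  "neg_log_lik G I ybar \<theta> =
     - (\<Sum>(a, b) \<in> {(a, b). a \<in> I \<and> b \<in> I \<and> a < b}.
          adj G a b * (ybar a b * ln (psi (\<theta> a - \<theta> b))
                       + (1 - ybar a b) * ln (1 - psi (\<theta> a - \<theta> b))))"

text \<open>\<open>\<rho> = 0\<close> is the unregularized estimator.\<close>

definition is_mle ::
    "real \<Rightarrow> nat pair_pre_digraph \<Rightarrow> nat set \<Rightarrow> (nat \<Rightarrow> nat \<Rightarrow> real) \<Rightarrow> (nat \<Rightarrow> real) \<Rightarrow> bool" where
  "is_mle \<rho> G I ybar \<theta> \<longleftrightarrow>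
     is_arg_min (\<lambda>\<theta>. neg_log_lik G I ybar \<theta> + \<rho> / 2 * (\<Sum>i\<in>I. (\<theta> i)\<^sup>2))
       (\<lambda>\<theta>. (\<Sum>i\<in>I. \<theta> i) = 0) \<theta>"

end

theory Submission
  imports Defs
begin

text \<open>
  \<open>d_inf\<close> measures distance modulo constant vectors, and the ensemble estimator glues shifted
  copies of the local estimators, so the bound follows from the triangle inequality along a path
  of overlaps leading into \<open>I 1\<close>, for each realization of the comparisons separately.

  Write \<open>d j\<close> for the error of the \<open>j\<close>-th estimator. Its error vector stays within \<open>d j\<close>
  of its own mean on \<open>I j\<close> (\<open>error_near_mean\<close>), so any two of its entries differ by at most
  \<open>2 * d j\<close> (\<open>error_oscillation\<close>). Let \<open>c\<close> be the mean error of the first estimator on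
  \<open>I 1\<close>. The shifts make the third estimator agree with the first at \<open>t1\<close>, and the second
  agree with the third at \<open>t2\<close>; walking from an item of \<open>I 2\<close> through \<open>t2\<close> and then \<open>t1\<close>
  into \<open>I 1\<close>, or from an item of \<open>I 3\<close> through \<open>t1\<close> alone, therefore shows that every entry of the glued error vector is within
  \<open>d 1 + 2 * d 2 + 2 * d 3\<close> of \<open>c\<close>. Replacing the centre \<open>c\<close> by the true mean costs at most
  a factor 2 (\<open>d_inf_le_twice_radius\<close>), which gives the constant 4.
\<close>

lemma error_near_mean:
  assumes "finite I" and "i \<in> I"
  shows "\<bar>(v i - w i) - (avg I v - avg I w)\<bar> \<le> d_inf I v w"
proof -
  have "\<bar>(v i - avg I v) - (w i - avg I w)\<bar> \<le> d_inf I v w"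
    unfolding d_inf_def using assms by (intro Max_ge) auto
  then show ?thesis by (simp add: algebra_simps)
qed

lemma error_oscillation:
  assumes "finite I" and "i \<in> I" and "j \<in> I"
  shows "\<bar>(v i - w i) - (v j - w j)\<bar> \<le> 2 * d_inf I v w"
  using error_near_mean[of I i v w] error_near_mean[of I j v w] assms by linarith

text \<open>
  The mean of numbers lying in an interval lies in that interval, hence each of them is at most
  the length \<open>2 * r\<close> of the interval away from it.
\<close>

lemma d_inf_le_twice_radius:
  assumes "finite I" and "I \<noteq> {}"
    and near: "\<And>i. i \<in> I \<Longrightarrow> \<bar>(v i - w i) - c\<bar> \<le> r"
  shows "d_inf I v w \<le> 2 * r"
proof -
  have card: "real (card I) > 0"
    using assms(1,2) by (simp add: card_gt_0_iff)
  have mean: "avg I v - avg I w = (\<Sum>i\<in>I. v i - w i) / real (card I)"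
    by (simp add: avg_def sum_subtractf diff_divide_distrib)
  have "(\<Sum>i\<in>I. v i - w i) \<le> real (card I) * (c + r)"
    using near by (intro sum_bounded_above) (fastforce simp: abs_le_iff)
  moreover have "real (card I) * (c - r) \<le> (\<Sum>i\<in>I. v i - w i)"
    using near by (intro sum_bounded_below) (fastforce simp: abs_le_iff)
  ultimately have mean_near: "\<bar>(avg I v - avg I w) - c\<bar> \<le> r"
    unfolding mean abs_le_iff using card by (simp add: field_simps)
  have "\<bar>(v i - avg I v) - (w i - avg I w)\<bar> \<le> 2 * r" if "i \<in> I" for i
    using near[OF that] mean_near by linarith
  then show ?thesis
    unfolding d_inf_def using assms(1,2) by simp
qed

theorem proposition6:
  fixes n :: nat
    and M :: "'w measure"
    and G :: "nat pair_pre_digraph"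
    and \<theta>s :: "nat \<Rightarrow> real"
    and L :: "nat \<Rightarrow> nat \<Rightarrow> nat"
    and Y :: "nat \<Rightarrow> nat \<Rightarrow> nat \<Rightarrow> 'w \<Rightarrow> bool"
    and I :: "nat \<Rightarrow> nat set"
    and K :: "nat \<Rightarrow> nat \<Rightarrow> nat \<Rightarrow> nat set"
    and \<rho> :: "nat \<Rightarrow> real"
    and \<theta>h :: "nat \<Rightarrow> nat \<Rightarrow> real"
    and \<theta>t :: "nat \<Rightarrow> nat \<Rightarrow> real"
    and \<theta>hat :: "nat \<Rightarrow> real"
    and \<delta>2 \<delta>3 :: real
    and t1 t2 :: nat
    and \<omega> :: 'w
  assumes "btl_model M G \<theta>s L Y"
    and "pverts G = {1..n}"
    and "(\<Union>j\<in>{1..3}. I j) = {1..n}"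
    and "\<And>j k. j \<in> {1..3} \<Longrightarrow> k \<in> {1..3} \<Longrightarrow> j \<noteq> k \<Longrightarrow> \<not> I j \<subseteq> I k"
    and "I 1 \<inter> I 3 \<noteq> {}" and "I 2 \<inter> I 3 \<noteq> {}"
    and "\<And>j. j \<in> {1..3} \<Longrightarrow> Digraph_Component.connected (with_proj G \<restriction> I j)"
    and "\<And>j a b. j \<in> {1..3} \<Longrightarrow> a \<in> I j \<Longrightarrow> b \<in> I j \<Longrightarrow> a < b \<Longrightarrow> (a, b) \<in> parcs G \<Longrightarrow>
           K j a b \<noteq> {} \<and> K j a b \<subseteq> {..<L a b}"
    and "\<And>j. j \<in> {1..3} \<Longrightarrow> 0 \<le> \<rho> j"
    and "\<omega> \<in> space M"
    and "\<And>j. j \<in> {1..3} \<Longrightarrow> is_mle (\<rho> j) G (I j) (win_frac Y (K j) \<omega>) (\<theta>h j)"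
    and "\<And>j. j \<in> {1..3} \<Longrightarrow> \<theta>t j = augment (I j) (\<theta>h j)"
    and "t1 \<in> I 1 \<inter> I 3" and "t2 \<in> I 2 \<inter> I 3"
    and "\<delta>3 = \<theta>t 1 t1 - \<theta>t 3 t1"
    and "\<delta>2 = \<theta>t 3 t2 - \<theta>t 2 t2"
    and "\<And>i. i \<in> I 1 \<Longrightarrow> \<theta>hat i = \<theta>h 1 i"
    and "\<And>i. i \<in> I 2 - I 1 \<Longrightarrow> \<theta>hat i = \<theta>t 2 i + \<delta>3 + \<delta>2"
    and "\<And>i. i \<in> I 3 - (I 1 \<union> I 2) \<Longrightarrow> \<theta>hat i = \<theta>t 3 i + \<delta>3"
  shows "d_inf {1..n} \<theta>hat \<theta>s \<le> 4 * (\<Sum>i\<in>{1..3}. d_inf (I i) (\<theta>h i) \<theta>s)"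
proof -
  define d where "d j = d_inf (I j) (\<theta>h j) \<theta>s" for j
  define c where "c = avg (I 1) (\<theta>h 1) - avg (I 1) \<theta>s"
  have cover: "I 1 \<union> I 2 \<union> I 3 = {1..n}"
  proof -
    have "{1..3} = {1, 2, 3::nat}" by auto
    then show ?thesis using assms(3) by auto
  qed
  have fin: "finite (I 1)" "finite (I 2)" "finite (I 3)"
    using finite_subset[OF _ finite_atLeastAtMost] cover by blast+
  have t: "t1 \<in> I 1" "t1 \<in> I 3" "t2 \<in> I 2" "t2 \<in> I 3"
    using assms(13,14) by auto
  have aug: "\<theta>t j i = \<theta>h j i" if "j \<in> {1..3}" "i \<in> I j" for j i
    using assms(12)[OF that(1)] that(2) by (simp add: augment_def)
  have \<delta>3: "\<delta>3 = \<theta>h 1 t1 - \<theta>h 3 t1" and \<delta>2: "\<delta>2 = \<theta>h 3 t2 - \<theta>h 2 t2"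
    using assms(15,16) aug t by auto
  have near1: "\<bar>(\<theta>h 1 i - \<theta>s i) - c\<bar> \<le> d 1" if "i \<in> I 1" for i
    using error_near_mean[OF fin(1) that] by (simp add: c_def d_def)
  have osc2: "\<bar>(\<theta>h 2 i - \<theta>s i) - (\<theta>h 2 j - \<theta>s j)\<bar> \<le> 2 * d 2"
    if "i \<in> I 2" "j \<in> I 2" for i j
    unfolding d_def by (rule error_oscillation[OF fin(2) that])
  have osc3: "\<bar>(\<theta>h 3 i - \<theta>s i) - (\<theta>h 3 j - \<theta>s j)\<bar> \<le> 2 * d 3"
    if "i \<in> I 3" "j \<in> I 3" for i j
    unfolding d_def by (rule error_oscillation[OF fin(3) that])
  have nonneg: "0 \<le> d 1" "0 \<le> d 2" "0 \<le> d 3"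
    using near1[OF t(1)] osc2[OF t(3) t(3)] osc3[OF t(2) t(2)] by auto
  have near: "\<bar>(\<theta>hat i - \<theta>s i) - c\<bar> \<le> d 1 + 2 * d 2 + 2 * d 3" if "i \<in> {1..n}" for i
  proof -
    from that cover consider "i \<in> I 1" | "i \<in> I 2 - I 1" | "i \<in> I 3 - (I 1 \<union> I 2)"
      by blast
    then show ?thesis
    proof cases
      case 1
      then show ?thesis using assms(17) near1 nonneg by force
    next
      case 2
      \<comment> \<open>The glued error splits into the oscillation of the second estimator up to \<open>t2\<close>, that of
        the third from \<open>t2\<close> to \<open>t1\<close>, and the error of the first at \<open>t1\<close>; the true scores at
        \<open>t1\<close> and \<open>t2\<close> cancel.\<close>
      have "(\<theta>hat i - \<theta>s i) - c =
          ((\<theta>h 2 i - \<theta>s i) - (\<theta>h 2 t2 - \<theta>s t2)) +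
          ((\<theta>h 3 t2 - \<theta>s t2) - (\<theta>h 3 t1 - \<theta>s t1)) + ((\<theta>h 1 t1 - \<theta>s t1) - c)"
        using assms(18)[OF 2] aug[of 2 i] 2 \<delta>2 \<delta>3 by simp
      then show ?thesis
        using osc2[of i t2] osc3[OF t(4,2)] near1[OF t(1)] 2 t(3) by auto
    next
      case 3
      have "(\<theta>hat i - \<theta>s i) - c =
          ((\<theta>h 3 i - \<theta>s i) - (\<theta>h 3 t1 - \<theta>s t1)) + ((\<theta>h 1 t1 - \<theta>s t1) - c)"
        using assms(19)[OF 3] aug[of 3 i] 3 \<delta>3 by simp
      then show ?thesis
        using osc3[of i t1] near1[OF t(1)] 3 t(2) nonneg by auto
    qed
  qed
  have "{1..n} \<noteq> {}" using cover t(1) by blast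
  then have "d_inf {1..n} \<theta>hat \<theta>s \<le> 2 * (d 1 + 2 * d 2 + 2 * d 3)"
    using near by (intro d_inf_le_twice_radius) auto
  also have "\<dots> \<le> 4 * (d 1 + d 2 + d 3)"
    using nonneg by simp
  also have "d 1 + d 2 + d 3 = (\<Sum>i\<in>{1..3}. d i)"
    by (simp add: numeral_3_eq_3 numeral_2_eq_2)
  finally show ?thesis by (simp add: d_def)
qed

end
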